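(* For every $q>1$, $\mathsf{Fish}(q\text{-}\mathsf{LL})>H_0/I_0$, and $\lim_{q\to\infty}\mathsf{Fish}(q\text{-}\mathsf{LL})=H_0/I_0$.
   Context: The sketch $q$-$\mathsf{LL}$ ($q>1$) has state space $\mathbb Z$ and, at cardinality $\lambda>0$, distribution $\psi_\lambda(k)=e^{-\lambda/q^k}-e^{-\lambda/q^{k-1}}$; $X_\lambda\sim\psi_\lambda$. With $H(X_\lambda)=-\sum_k\psi_\lambda(k)\log_2\psi_\lambda(k)$ and $I(\lambda)=\sum_k(\frac{\partial}{\partial\lambda}\psi_\lambda(k))^2/\psi_\lambda(k)$, define $\mathcal{H}=\int_0^1H(X_{q^r})\,dr$, $\mathcal{I}=\int_0^1q^{2r}I(q^r)\,dr$ and $\mathsf{Fish}(q\text{-}\mathsf{LL})=\mathcal H/\mathcal I$. Constants: with $h(x)=-x\ln x-(1-x)\ln(1-x)$ and $g(x)=x^2/(e^x-1)$, $H_0=\frac1{\ln2}\int_{-\infty}^\infty h(e^{-e^w})\,dw$ and $I_0=\int_{-\infty}^\infty g(e^w)\,dw$. *)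

theory Defs
  imports "HOL-Analysis.Analysis"
begin

text \<open>Distribution of the sketch q-LL at cardinality lam, on state space int.\<close>
definition psi :: "real \<Rightarrow> real \<Rightarrow> int \<Rightarrow> real" where
  "psi q lam k = exp (- lam / q powr (real_of_int k)) - exp (- lam / q powr (real_of_int k - 1))"

definition entropyLL :: "real \<Rightarrow> real \<Rightarrow> real" where
  "entropyLL q lam = - (\<Sum>\<^sub>\<infinity>k\<in>(UNIV::int set). psi q lam k * log 2 (psi q lam k))"

definition fisherLL :: "real \<Rightarrow> real \<Rightarrow> real" where
  "fisherLL q lam = (\<Sum>\<^sub>\<infinity>k\<in>(UNIV::int set). (deriv (\<lambda>l. psi q l k) lam)\<^sup>2 / psi q lam k)"

definition calH :: "real \<Rightarrow> real" where
  "calH q = integral {0..1} (\<lambda>r. entropyLL q (q powr r))"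

definition calI :: "real \<Rightarrow> real" where
  "calI q = integral {0..1} (\<lambda>r. q powr (2 * r) * fisherLL q (q powr r))"

definition Fish :: "real \<Rightarrow> real" where
  "Fish q = calH q / calI q"

definition hbin :: "real \<Rightarrow> real" where
  "hbin x = - x * ln x - (1 - x) * ln (1 - x)"

definition gfun :: "real \<Rightarrow> real" where
  "gfun x = x\<^sup>2 / (exp x - 1)"

definition H0 :: real where
  "H0 = (1 / ln 2) * integral UNIV (\<lambda>w. hbin (exp (- exp w)))"

definition I0 :: real where
  "I0 = integral UNIV (\<lambda>w. gfun (exp w))"

end

theory Submission
  imports Defs
begin

text \<open>Put \<open>a = q\<^sup>w\<close>, \<open>b = q a\<close> and \<open>d = b - a\<close>. Since exponential variables are memoryless, the chain
  rules for entropy and Fisher information turn the summands at \<open>p = e\<^sup>-\<^sup>a - e\<^sup>-\<^sup>b\<close> into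
  \<open>- p ln p = a e\<^sup>-\<^sup>a - b e\<^sup>-\<^sup>b + e\<^sup>-\<^sup>a h(e\<^sup>-\<^sup>d)\<close> and
  \<open>(b e\<^sup>-\<^sup>b - a e\<^sup>-\<^sup>a)\<^sup>2 / p = a\<^sup>2 e\<^sup>-\<^sup>a - b\<^sup>2 e\<^sup>-\<^sup>b + e\<^sup>-\<^sup>a g(d)\<close>.
  Summing over \<open>k\<close> and averaging over \<open>r\<close> gives integrals over the line in which the first two terms
  cancel. With \<open>s = 1/(q - 1)\<close> and up to the common factor \<open>1/ln q\<close>, there remain the integrals of
  \<open>h(exp (- e\<^sup>v)) / ln 2\<close> and \<open>g(e\<^sup>v)\<close> against the weight \<open>exp (- s e\<^sup>v)\<close>. The weight and the quotient
  \<open>h(e\<^sup>-\<^sup>x)/g(x)\<close> are both strictly decreasing, so by Chebyshev's integral inequality the ratio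
  exceeds its value at \<open>s = 0\<close>, and it converges to that value by dominated convergence.\<close>

section \<open>Integrals over the line\<close>

text \<open>A nonnegative function with zero integral vanishes almost everywhere, which is
  impossible off a single point. The exceptional point allows for the zero of the integrand in
  Chebyshev's inequality.\<close>

lemma integral_pos_except_point:
  fixes f :: "real \<Rightarrow> real"
  assumes f: "integrable lborel f" and nonneg: "\<And>x. 0 \<le> f x" and pos: "\<And>x. x \<noteq> a \<Longrightarrow> 0 < f x"
  shows "0 < (\<integral>x. f x \<partial>lborel)"
proof -
  have "(\<integral>x. f x \<partial>lborel) \<noteq> 0"
  proof
    assume "(\<integral>x. f x \<partial>lborel) = 0"
    then have "AE x in lborel. f x = 0"
      using integral_nonneg_eq_0_iff_AE[OF f] nonneg by simp
    moreover have "AE x in lborel. x \<noteq> a"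
      by (rule AE_lborel_singleton)
    ultimately have "AE x::real in lborel. False"
    proof eventually_elim
      case (elim x)
      then show ?case using pos[of x] by simp
    qed
    then show False
      by (simp add: AE_iff_measurable[of UNIV])
  qed
  moreover have "0 \<le> (\<integral>x. f x \<partial>lborel)"
    using nonneg by simp
  ultimately show ?thesis by linarith
qed

text \<open>The common dominating function for all integrands in the logarithmic variable, bounded
  by a half-line exponential plus its reflection.\<close>

lemma integrable_exp_neg_abs_half: "integrable lborel (\<lambda>x::real. exp (- \<bar>x\<bar> / 2))"
proof -
  let ?e = "\<lambda>x::real. indicator {0..} x * exp (- (1/2) * x)"
  have "integral\<^sup>N lborel ?e = ennreal (exp (- (1/2) * 0) / (1/2))"
    by (rule nn_integral_has_integral_lebesgue[OF _ has_integral_exp_minus_to_infinity]) auto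
  then have e: "integrable lborel ?e"
    by (rule integrableI_nn_integral_finite[rotated 2]) auto
  have "integrable lborel (\<lambda>x. ?e (0 + (-1) * x))"
    by (rule lborel_integrable_real_affine[OF e]) simp
  then have "integrable lborel (\<lambda>x. ?e x + ?e (0 + (-1) * x))"
    using e by (rule Bochner_Integration.integrable_add[rotated])
  then show ?thesis
    by (rule Bochner_Integration.integrable_bound)
      (auto intro!: AE_I2 split: split_indicator)
qed

text \<open>Integer translates of the unit interval tile the line, so Tonelli exchanges the sum over
  \<open>k\<close> with the integral over \<open>r\<close>. Finiteness of the total makes the sum
  finite for almost every \<open>r\<close>.\<close>

lemma has_integral_periodization:
  fixes F :: "real \<Rightarrow> real"
  assumes F: "integrable lborel F" and nonneg: "\<And>x. 0 \<le> F x"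
  shows "((\<lambda>r. \<Sum>\<^sub>\<infinity>k\<in>(UNIV::int set). F (r - of_int k)) has_integral (\<integral>x. F x \<partial>lborel)) {0..1}"
proof -
  have [measurable]: "F \<in> borel_measurable borel"
    using borel_measurable_integrable[OF F] by simp
  \<comment> \<open>The half-open interval makes the translates disjoint. At \<open>r = 1\<close>
    this gives \<open>N r = 0\<close>, so that point is excluded later as a null set.\<close>
  define N where "N r = (\<integral>\<^sup>+k. ennreal (F (r - of_int k)) * indicator {0..<1} r \<partial>count_space (UNIV::int set))" for r
  have N_meas[measurable]: "N \<in> borel_measurable borel"
  proof -
    \<comment> \<open>Enumerating the integers by \<open>int_decode\<close> gives a countable sum of
      measurable functions.\<close>
    have "(\<lambda>r. \<integral>\<^sup>+k. ennreal (F (r - of_int k)) * indicator {0..<1} r \<partial>count_space (UNIV::int set))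
        = (\<lambda>r. \<Sum>i. ennreal (F (r - of_int (int_decode i))) * indicator {0..<1} r)"
      unfolding nn_integral_count_space_nat[symmetric]
      by (intro ext nn_integral_bij_count_space[OF bij_int_decode, symmetric])
    then show ?thesis
      unfolding N_def by simp
  qed
  have cell: "indicator {- of_int k ..< - of_int k + 1} x = (indicator {- \<lfloor>x\<rfloor>} k :: ennreal)" for k :: int and x :: real
  proof -
    have "x \<in> {- of_int k ..< - of_int k + 1} \<longleftrightarrow> k \<in> {- \<lfloor>x\<rfloor>}"
      using floor_eq_iff[of x "- k"] by auto
    then show ?thesis unfolding indicator_def by simp
  qed
  have "ennreal (\<integral>x. F x \<partial>lborel) = (\<integral>\<^sup>+x. F x \<partial>lborel)"
    by (rule nn_integral_eq_integral[symmetric]) (use F nonneg in auto)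
  also have "\<dots> = (\<integral>\<^sup>+x. (\<integral>\<^sup>+k. ennreal (F x) * indicator {- of_int k ..< - of_int k + 1} x \<partial>count_space (UNIV::int set)) \<partial>lborel)"
    unfolding cell by (simp add: nn_integral_cmult)
  also have "\<dots> = (\<integral>\<^sup>+k. (\<integral>\<^sup>+x. ennreal (F x) * indicator {- of_int k ..< - of_int k + 1} x \<partial>lborel) \<partial>count_space (UNIV::int set))"
    by (rule nn_integral_count_space_nn_integral) auto
  also have "\<dots> = (\<integral>\<^sup>+k. (\<integral>\<^sup>+r. ennreal (F (r - of_int k)) * indicator {0..<1} r \<partial>lborel) \<partial>count_space (UNIV::int set))"
  proof (rule nn_integral_cong)
    fix k :: int
    show "(\<integral>\<^sup>+x. ennreal (F x) * indicator {- of_int k ..< - of_int k + 1} x \<partial>lborel)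
        = (\<integral>\<^sup>+r. ennreal (F (r - of_int k)) * indicator {0..<1} r \<partial>lborel)"
      by (subst nn_integral_real_affine[where c = 1 and t = "- of_int k"])
        (auto intro!: nn_integral_cong split: split_indicator)
  qed
  also have "\<dots> = (\<integral>\<^sup>+r. N r \<partial>lborel)"
    unfolding N_def by (rule nn_integral_count_space_nn_integral[symmetric]) auto
  finally have N: "(\<integral>\<^sup>+r. N r \<partial>lborel) = ennreal (\<integral>x. F x \<partial>lborel)" ..
  then have fin: "AE r in lborel. N r \<noteq> \<infinity>"
    by (intro nn_integral_PInf_AE) auto
  have "(\<integral>\<^sup>+r. ennreal (enn2real (N r)) \<partial>lborel) = (\<integral>\<^sup>+r. N r \<partial>lborel)"
    by (rule nn_integral_cong_AE) (use fin in eventually_elim, auto simp: less_top)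
  with N have "has_bochner_integral lborel (\<lambda>r. enn2real (N r)) (\<integral>x. F x \<partial>lborel)"
    by (intro has_bochner_integral_nn_integral) (auto simp: nonneg)
  then have "((\<lambda>r. enn2real (N r)) has_integral (\<integral>x. F x \<partial>lborel)) UNIV"
    using has_integral_integral_lborel[of "\<lambda>r. enn2real (N r)"] by (simp add: has_bochner_integral_iff)
  moreover have "(\<lambda>r. enn2real (N r)) = (\<lambda>r. if r \<in> {0..1} then enn2real (N r) else 0)"
    by (auto simp: N_def fun_eq_iff)
  ultimately have *: "((\<lambda>r. enn2real (N r)) has_integral (\<integral>x. F x \<partial>lborel)) {0..1}"
    by (metis has_integral_restrict_UNIV)
  have "AE r in lborel. r \<in> {0..1} \<longrightarrow> (\<Sum>\<^sub>\<infinity>k\<in>(UNIV::int set). F (r - of_int k)) = enn2real (N r)"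
    using fin AE_lborel_singleton[of "1::real"]
  proof eventually_elim
    case (elim r)
    show ?case
    proof
      assume "r \<in> {0..1}"
      then have Nr: "N r = (\<integral>\<^sup>+k. ennreal (F (r - of_int k)) \<partial>count_space (UNIV::int set))"
        using elim by (simp add: N_def)
      have "integrable (count_space (UNIV::int set)) (\<lambda>k. F (r - of_int k))"
        by (rule integrableI_nonneg) (use elim Nr nonneg in \<open>auto simp: less_top\<close>)
      then have s: "Infinite_Set_Sum.abs_summable_on (\<lambda>k. F (r - of_int k)) (UNIV::int set)"
        by (simp add: Infinite_Set_Sum.abs_summable_on_def)
      have "N r = ennreal (infsetsum (\<lambda>k. F (r - of_int k)) (UNIV::int set))"
        unfolding Nr by (rule nn_integral_conv_infsetsum[OF s]) (rule nonneg)
      then show "(\<Sum>\<^sub>\<infinity>k\<in>(UNIV::int set). F (r - of_int k)) = enn2real (N r)"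
        unfolding infsetsum_infsum[OF s] by (simp add: infsum_nonneg nonneg)
    qed
  qed
  from has_integral_AE[OF this] * show ?thesis by blast
qed

text \<open>The proof of Chebyshev's inequality compares \<open>w\<close> and \<open>R\<close> with their values at the point
  where \<open>R\<close> equals its \<open>g\<close>-average.\<close>

lemma integral_decreasing_correlation:
  fixes R g w :: "real \<Rightarrow> real"
  assumes R_cont: "continuous_on UNIV R"
    and R_dec: "\<And>x y. x < y \<Longrightarrow> R y < R x" and w_dec: "\<And>x y. x < y \<Longrightarrow> w y < w x"
    and g_pos: "\<And>x. 0 < g x"
    and int: "integrable lborel g" "integrable lborel (\<lambda>x. R x * g x)"
      "integrable lborel (\<lambda>x. w x * g x)" "integrable lborel (\<lambda>x. w x * (R x * g x))"
  shows "(\<integral>x. R x * g x \<partial>lborel) * (\<integral>x. w x * g x \<partial>lborel)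
    < (\<integral>x. w x * (R x * g x) \<partial>lborel) * (\<integral>x. g x \<partial>lborel)"
proof -
  define G where "G = (\<integral>x. g x \<partial>lborel)"
  define c where "c = (\<integral>x. R x * g x \<partial>lborel) / G"
  have G: "0 < G"
    unfolding G_def by (rule integral_pos_except_point[OF int(1), of 0]) (auto simp: g_pos less_imp_le)
  have int_c: "integrable lborel (\<lambda>x. (R x - c) * g x)"
    using int by (simp add: left_diff_distrib)
  have zero: "(\<integral>x. (R x - c) * g x \<partial>lborel) = 0"
    using int G by (simp add: left_diff_distrib c_def flip: G_def)
  \<comment> \<open>If \<open>R\<close> stayed strictly on one side of its average \<open>c\<close>,
    the integral in \<open>zero\<close> could not vanish.\<close>
  have "\<exists>x. R x \<le> c"
  proof (rule ccontr)
    assume "\<not> ?thesis"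
    then have "0 < (\<integral>x. (R x - c) * g x \<partial>lborel)"
      by (intro integral_pos_except_point[OF int_c, of 0])
        (auto simp: g_pos less_imp_le not_le intro!: mult_nonneg_nonneg)
    with zero show False by simp
  qed
  moreover have "\<exists>x. c \<le> R x"
  proof (rule ccontr)
    assume neg: "\<not> ?thesis"
    have "integrable lborel (\<lambda>x. - ((R x - c) * g x))"
      using int_c by simp
    then have "0 < (\<integral>x. - ((R x - c) * g x) \<partial>lborel)"
      using neg by (intro integral_pos_except_point[where a = 0])
        (auto simp: g_pos less_imp_le not_le mult_less_0_iff mult_le_0_iff)
    with zero show False by simp
  qed
  ultimately obtain x1 x2 where x12: "R x1 \<le> c" "c \<le> R x2" by blast
  have "x2 \<le> x1 \<or> R x1 = c"
    using R_dec[of x1 x2] x12 by linarith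
  then obtain a where a: "R a = c"
    using IVT2'[of R x1 c x2] x12 continuous_on_subset[OF R_cont] by blast
  \<comment> \<open>The last term integrates to zero, so replacing \<open>w x\<close> by
    \<open>w x - w a\<close> does not change the integral against
    \<open>(R x - c) * g x\<close>.\<close>
  have eq: "(w x - w a) * ((R x - c) * g x)
      = w x * (R x * g x) - c * (w x * g x) - w a * ((R x - c) * g x)" for x
    by (simp add: algebra_simps)
  have pos: "0 < (w x - w a) * ((R x - c) * g x)" if "x \<noteq> a" for x
  proof (cases "x < a")
    case True
    then show ?thesis using R_dec[of x a] w_dec[of x a] g_pos[of x] a by simp
  next
    case False
    with that have "a < x" by simp
    then have "0 < (w a - w x) * ((c - R x) * g x)"
      using R_dec[of a x] w_dec[of a x] g_pos[of x] a by simp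
    then show ?thesis by (simp add: algebra_simps)
  qed
  have "0 < (\<integral>x. (w x - w a) * ((R x - c) * g x) \<partial>lborel)"
  proof (rule integral_pos_except_point[where a = a])
    show "integrable lborel (\<lambda>x. (w x - w a) * ((R x - c) * g x))"
      unfolding eq using int int_c by simp
    show "0 \<le> (w x - w a) * ((R x - c) * g x)" for x
      using pos[of x] by (cases "x = a") auto
  qed (rule pos)
  also have "\<dots> = (\<integral>x. w x * (R x * g x) \<partial>lborel) - c * (\<integral>x. w x * g x \<partial>lborel)"
    unfolding eq using int int_c zero by simp
  finally show ?thesis
    using G by (simp add: c_def field_simps flip: G_def)
qed

section \<open>The quotient of entropy and Fisher integrands\<close>

text \<open>The numerator of the derivative is \<open>(1 + t) * exp (- t) - 1\<close>, negative
  because \<open>1 + t < exp t\<close>.\<close>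

lemma one_minus_exp_over_decreasing:
  fixes x y :: real
  assumes "0 < x" "x < y"
  shows "(1 - exp (- y)) / y < (1 - exp (- x)) / x"
proof (rule DERIV_neg_imp_decreasing[OF assms(2)])
  fix t assume "x \<le> t" "t \<le> y"
  with assms have t: "0 < t" by simp
  have "1 + t < exp t"
    using exp_lower_Taylor_quadratic[of t] t by (smt (verit) zero_less_power divide_pos_pos)
  then have "(1 + t) * exp (- t) < exp t * exp (- t)"
    by (intro mult_strict_right_mono) auto
  then have "exp (- t) * t - (1 - exp (- t)) < 0"
    by (simp add: algebra_simps flip: exp_add)
  then have "(exp (- t) * t - (1 - exp (- t))) / (t * t) < 0"
    using t by (simp add: divide_neg_pos)
  moreover have "((\<lambda>x. (1 - exp (- x)) / x) has_real_derivative
      (exp (- t) * t - (1 - exp (- t))) / (t * t)) (at t)"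
    using t by (auto intro!: derivative_eq_intros)
  ultimately show "\<exists>d. ((\<lambda>x. (1 - exp (- x)) / x) has_real_derivative d) (at t) \<and> d < 0"
    by blast
qed

text \<open>With \<open>z = 1 - exp (- t)\<close> the derivative is
  \<open>- exp t * ln z - 1 / z\<close>. Its sign follows from
  \<open>ln (1 / z) \<le> 1 / z - 1\<close> and \<open>exp t = 1 / (1 - z)\<close>.\<close>

lemma exp_ln_one_minus_exp_decreasing:
  fixes x y :: real
  assumes "0 < x" "x \<le> y"
  shows "- exp y * ln (1 - exp (- y)) \<le> - exp x * ln (1 - exp (- x))"
proof (rule DERIV_nonpos_imp_nonincreasing[OF assms(2)])
  fix t assume "x \<le> t" "t \<le> y"
  with assms have t: "0 < t" by simp
  define z where "z = 1 - exp (- t)"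
  have z: "0 < z" "exp t * (1 - z) = 1"
    using t by (auto simp: z_def simp flip: exp_add)
  have "ln (1 / z) \<le> 1 / z - 1"
    using z by (intro ln_le_minus_one) simp
  then have "- ln z \<le> (1 - z) / z"
    using z by (simp add: ln_div field_simps)
  then have "exp t * (- ln z - (1 - z) / z) \<le> 0"
    by (intro mult_nonneg_nonpos) auto
  then have "- exp t * ln z - 1 / z \<le> 0"
    using z by (simp add: right_diff_distrib)
  moreover have "((\<lambda>x. - exp x * ln (1 - exp (- x))) has_real_derivative
      - exp t * ln (1 - exp (- t)) - 1 / z) (at t)"
  proof -
    have "((\<lambda>x. - exp x * ln (1 - exp (- x))) has_real_derivative
        - exp t * ln z - exp t * exp (- t) / z) (at t)"
      using t by (auto intro!: derivative_eq_intros simp: z_def)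
    moreover have "exp t * exp (- t) = 1"
      by (simp flip: exp_add)
    ultimately show ?thesis by (simp add: z_def)
  qed
  ultimately show "\<exists>d. ((\<lambda>x. - exp x * ln (1 - exp (- x))) has_real_derivative d) (at t) \<and> d \<le> 0"
    unfolding z_def by blast
qed

text \<open>With \<open>A x = (1 - e\<^sup>-\<^sup>x)/x\<close> and \<open>B x = - e\<^sup>x ln (1 - e\<^sup>-\<^sup>x)\<close> this is \<open>A (1 + A B)\<close>, a form of
  \<open>h(e\<^sup>-\<^sup>x)/g(x)\<close> in which monotonicity is visible, as \<open>A\<close> and \<open>B\<close> are positive and decreasing.\<close>

definition hg_quotient :: "real \<Rightarrow> real" where
  "hg_quotient x = (1 - exp (- x)) / x * (1 + (1 - exp (- x)) / x * (- exp x * ln (1 - exp (- x))))"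

lemma hg_quotient_strict_decreasing:
  assumes "0 < x" "x < y"
  shows "hg_quotient y < hg_quotient x"
proof -
  have A: "(1 - exp (- y)) / y < (1 - exp (- x)) / x" "0 < (1 - exp (- y)) / y"
    using one_minus_exp_over_decreasing assms by auto
  have B: "- exp y * ln (1 - exp (- y)) \<le> - exp x * ln (1 - exp (- x))"
    using exp_ln_one_minus_exp_decreasing assms by auto
  have B0: "0 \<le> - exp y * ln (1 - exp (- y))"
    using assms by (simp add: mult_nonneg_nonpos ln_le_zero_iff)
  \<comment> \<open>Weak monotonicity suffices here: strictness comes from the outer factor
    \<open>(1 - exp (- x)) / x\<close>.\<close>
  have "(1 - exp (- y)) / y * (- exp y * ln (1 - exp (- y)))
      \<le> (1 - exp (- x)) / x * (- exp x * ln (1 - exp (- x)))"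
    by (rule mult_mono) (use A B B0 in linarith)+
  moreover have "0 \<le> (1 - exp (- y)) / y * (- exp y * ln (1 - exp (- y)))"
    by (rule mult_nonneg_nonneg) (use A B0 in linarith)+
  ultimately show ?thesis
    unfolding hg_quotient_def using A by (intro mult_less_le_imp_less) auto
qed

lemma hbin_eq_hg_quotient:
  assumes "0 < x"
  shows "hbin (exp (- x)) = hg_quotient x * gfun x"
proof -
  \<comment> \<open>Treating \<open>exp x\<close> and \<open>ln (1 - exp (- x))\<close> as
    independent quantities \<open>E\<close> and \<open>L\<close> leaves an identity of rational
    functions.\<close>
  have *: "x * (1 / E) - (1 - 1 / E) * L
      = (1 - 1 / E) / x * (1 + (1 - 1 / E) / x * (- E * L)) * (x\<^sup>2 / (E - 1))" if "1 < E" for E L :: real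
  proof -
    have A: "(1 - 1 / E) / x = (E - 1) / (E * x)"
      using that assms by (simp add: field_simps)
    have "(E - 1) / (E * x) * (1 + (E - 1) / (E * x) * (- E * L)) * (x\<^sup>2 / (E - 1))
        = x / E * (1 - (E - 1) * L / x)"
      using that assms by (simp add: power2_eq_square)
    also have "\<dots> = x * (1 / E) - (1 - 1 / E) * L"
      using that assms by (simp add: right_diff_distrib left_diff_distrib diff_divide_distrib)
    finally show ?thesis
      unfolding A by simp
  qed
  show ?thesis
    using *[of "exp x" "ln (1 - exp (- x))"] assms
    unfolding hbin_def hg_quotient_def gfun_def ln_exp by (simp add: exp_minus inverse_eq_divide)
qed

lemma gfun_pos: "0 < x \<Longrightarrow> 0 < gfun x"
  by (simp add: gfun_def)

lemma hbin_nonneg: "0 < x \<Longrightarrow> x < 1 \<Longrightarrow> 0 \<le> hbin x"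
  unfolding hbin_def using mult_nonneg_nonpos[of x "ln x"] mult_nonneg_nonpos[of "1 - x" "ln (1 - x)"]
  by simp

section \<open>Integrability\<close>

lemma exp_neg_abs_half_eq:
  "x \<le> 0 \<Longrightarrow> exp (- \<bar>x\<bar> / 2) = sqrt (exp x)" "0 \<le> x \<Longrightarrow> exp (- \<bar>x\<bar> / 2) = 1 / sqrt (exp x)"
  for x :: real
proof -
  have "sqrt (exp x) = exp (x / 2)"
    by (rule real_sqrt_unique) (simp_all add: power2_eq_square flip: exp_add)
  then show "x \<le> 0 \<Longrightarrow> exp (- \<bar>x\<bar> / 2) = sqrt (exp x)" "0 \<le> x \<Longrightarrow> exp (- \<bar>x\<bar> / 2) = 1 / sqrt (exp x)"
    by (simp_all add: exp_minus inverse_eq_divide)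
qed

text \<open>At \<open>x = exp v\<close> the bounds \<open>sqrt x\<close> near zero and
  \<open>1 / sqrt x\<close> near infinity become the single envelope
  \<open>exp (- \<bar>v\<bar> / 2)\<close>.\<close>

lemma integrable_exp_decay:
  fixes f :: "real \<Rightarrow> real"
  assumes f: "(\<lambda>v. f (exp v)) \<in> borel_measurable borel"
    and small: "\<And>x. 0 < x \<Longrightarrow> x \<le> 1 \<Longrightarrow> \<bar>f x\<bar> \<le> C * sqrt x"
    and large: "\<And>x. 1 \<le> x \<Longrightarrow> \<bar>f x\<bar> \<le> C / sqrt x"
  shows "integrable lborel (\<lambda>v. f (exp v))"
proof -
  have le: "\<bar>f (exp v)\<bar> \<le> C * exp (- \<bar>v\<bar> / 2)" for v
  proof (cases "v \<le> 0")
    case True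
    with small[of "exp v"] show ?thesis
      unfolding exp_neg_abs_half_eq(1)[OF True] by simp
  next
    case False
    then have "0 \<le> v" by simp
    with large[of "exp v"] show ?thesis
      unfolding exp_neg_abs_half_eq(2)[OF \<open>0 \<le> v\<close>] by simp
  qed
  have "integrable lborel (\<lambda>v. C * exp (- \<bar>v\<bar> / 2))"
    using integrable_exp_neg_abs_half by simp
  then show ?thesis
  proof (rule Bochner_Integration.integrable_bound)
    show "AE v in lborel. norm (f (exp v)) \<le> norm (C * exp (- \<bar>v\<bar> / 2))"
      unfolding real_norm_def by (intro AE_I2 order_trans[OF le abs_ge_self])
  qed (use f in simp)
qed

text \<open>Expand \<open>(1 + x / 3) ^ 3 \<le> exp x\<close> and keep the cubic term. Degree three
  leaves decay \<open>1 / x\<close> after multiplication by \<open>x\<^sup>2\<close>.\<close>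

lemma exp_minus_le_cube:
  fixes x :: real
  assumes "0 < x"
  shows "exp (- x) \<le> 27 / x ^ 3" "x ^ 3 / 27 \<le> exp x - 1"
proof -
  have "(1 + x / 3) ^ 3 \<le> exp (x / 3) ^ 3"
    using assms by (intro power_mono) auto
  also have "\<dots> = exp x"
    by (simp flip: exp_of_nat_mult)
  finally have e: "1 + x + x\<^sup>2 / 3 + x ^ 3 / 27 \<le> exp x"
    by (simp add: power2_eq_square power3_eq_cube field_simps)
  then show "x ^ 3 / 27 \<le> exp x - 1"
    using assms zero_le_power2[of x] by linarith
  then have "x ^ 3 / 27 \<le> exp x" by simp
  then show "exp (- x) \<le> 27 / x ^ 3"
    using assms by (simp add: exp_minus field_simps)
qed

lemma sqrt_sandwich:
  fixes x :: real
  shows "0 < x \<Longrightarrow> x \<le> 1 \<Longrightarrow> x \<le> sqrt x" "1 \<le> x \<Longrightarrow> 1 / x \<le> 1 / sqrt x"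
proof -
  show "x \<le> sqrt x" if "0 < x" "x \<le> 1"
    using that by (intro real_le_rsqrt) (simp add: power2_eq_square mult_left_le_one_le)
  show "1 / x \<le> 1 / sqrt x" if "1 \<le> x"
    using that by (intro divide_left_mono real_le_lsqrt) (auto simp: power2_eq_square)
qed

text \<open>These are the telescoping terms: \<open>n = 1\<close> for entropy and
  \<open>n = 2\<close> for Fisher information.\<close>

lemma integrable_power_exp_exp:
  assumes "n \<in> {1, 2}"
  shows "integrable lborel (\<lambda>v::real. exp v ^ n * exp (- exp v))"
proof (rule integrable_exp_decay[where C = 27])
  fix x :: real
  assume x: "0 < x" "x \<le> 1"
  have "x ^ n * exp (- x) \<le> x * 1"
    using x assms by (intro mult_mono) (auto simp: power2_eq_square mult_left_le_one_le)
  then show "\<bar>x ^ n * exp (- x)\<bar> \<le> 27 * sqrt x"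
    using sqrt_sandwich(1)[OF x] x by (simp add: abs_mult)
next
  fix x :: real
  assume x: "1 \<le> x"
  have "x ^ n * exp (- x) \<le> x\<^sup>2 * (27 / x ^ 3)"
    using x assms exp_minus_le_cube[of x] by (intro mult_mono) (auto simp: power2_eq_square)
  also have "\<dots> = 27 * (1 / x)"
    using x by (simp add: field_simps power2_eq_square power3_eq_cube)
  also have "\<dots> \<le> 27 * (1 / sqrt x)"
    using sqrt_sandwich(2)[OF x] by simp
  finally show "\<bar>x ^ n * exp (- x)\<bar> \<le> 27 / sqrt x"
    using x by (simp add: abs_mult)
qed simp

lemma integrable_gfun: "integrable lborel (\<lambda>v. gfun (exp v))"
proof (rule integrable_exp_decay[where C = 27])
  show "(\<lambda>v. gfun (exp v)) \<in> borel_measurable borel"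
    unfolding gfun_def by measurable
next
  fix x :: real
  assume x: "0 < x" "x \<le> 1"
  have "gfun x \<le> x\<^sup>2 / x"
    unfolding gfun_def by (intro divide_left_mono) (use x exp_ge_add_one_self[of x] in \<open>auto simp del: exp_ge_add_one_self\<close>)
  then show "\<bar>gfun x\<bar> \<le> 27 * sqrt x"
    using sqrt_sandwich(1)[OF x] x gfun_pos[of x] by (simp add: power2_eq_square)
next
  fix x :: real
  assume x: "1 \<le> x"
  have "gfun x \<le> x\<^sup>2 / (x ^ 3 / 27)"
    unfolding gfun_def using x exp_minus_le_cube[of x] by (intro divide_left_mono) auto
  also have "\<dots> = 27 * (1 / x)"
    using x by (simp add: field_simps power2_eq_square power3_eq_cube)
  also have "\<dots> \<le> 27 * (1 / sqrt x)"
    using sqrt_sandwich(2)[OF x] by simp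
  finally show "\<bar>gfun x\<bar> \<le> 27 / sqrt x"
    using x gfun_pos[of x] by simp
qed

text \<open>Both bounds come from \<open>- ln u \<le> 1 / u - 1\<close>, at
  \<open>u = sqrt z\<close> and at \<open>u = z\<close>. The first is useful near
  \<open>z = 0\<close>, the second near \<open>z = 1\<close>.\<close>

lemma neg_mult_ln_le:
  fixes z :: real
  assumes "0 < z"
  shows "- z * ln z \<le> 2 * sqrt z" "- z * ln z \<le> 1 - z"
proof -
  have *: "- ln u \<le> 1 / u - 1" if "0 < u" for u :: real
    using ln_le_minus_one[of "1 / u"] that by (simp add: ln_div)
  have "- ln z = 2 * - ln (sqrt z)"
    using assms by (simp add: ln_sqrt)
  also have "\<dots> \<le> 2 * (1 / sqrt z)"
    using *[of "sqrt z"] assms by simp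
  finally have "z * - ln z \<le> z * (2 * (1 / sqrt z))"
    using assms by (intro mult_left_mono) auto
  also have "\<dots> = 2 * (z / sqrt z)"
    by simp
  also have "z / sqrt z = sqrt z"
    using assms by (simp add: real_div_sqrt)
  finally show "- z * ln z \<le> 2 * sqrt z" by simp
  have "z * - ln z \<le> z * (1 / z - 1)"
    using *[of z] assms by (intro mult_left_mono) auto
  then show "- z * ln z \<le> 1 - z"
    using assms by (simp add: algebra_simps)
qed

lemma integrable_hbin: "integrable lborel (\<lambda>v. hbin (exp (- exp v)))"
\<comment> \<open>The constant is \<open>2 * 27\<close>, from
  \<open>x + 1 \<le> 2 * x\<^sup>2\<close> and the cubic bound for large \<open>x\<close>; for small
  \<open>x\<close> the estimates give 3.\<close>
proof (rule integrable_exp_decay[where C = 54 and f = "\<lambda>x. hbin (exp (- x))"])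
  show "(\<lambda>v. hbin (exp (- exp v))) \<in> borel_measurable borel"
    unfolding hbin_def by measurable
next
  fix x :: real
  assume x: "0 < x" "x \<le> 1"
  let ?z = "1 - exp (- x)"
  have z: "0 < ?z" "?z \<le> x"
    using x exp_ge_add_one_self[of "- x"] by auto
  have "hbin (exp (- x)) = x * exp (- x) + - ?z * ln ?z"
    by (simp add: hbin_def algebra_simps)
  also have "\<dots> \<le> x * 1 + 2 * sqrt ?z"
    using x neg_mult_ln_le[OF z(1)] by (intro add_mono mult_left_mono) auto
  also have "\<dots> \<le> sqrt x + 2 * sqrt x"
    using sqrt_sandwich(1)[OF x] z by (intro add_mono) auto
  finally have "hbin (exp (- x)) \<le> 54 * sqrt x"
    using x by (smt (verit) real_sqrt_ge_0_iff)
  then show "\<bar>hbin (exp (- x))\<bar> \<le> 54 * sqrt x"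
    using x hbin_nonneg[of "exp (- x)"] by simp
next
  fix x :: real
  assume x: "1 \<le> x"
  let ?z = "1 - exp (- x)"
  have z: "0 < ?z"
    using x by auto
  have "hbin (exp (- x)) = x * exp (- x) + - ?z * ln ?z"
    by (simp add: hbin_def algebra_simps)
  also have "\<dots> \<le> x * exp (- x) + exp (- x)"
    using neg_mult_ln_le(2)[OF z] by simp
  also have "\<dots> \<le> (2 * x\<^sup>2) * exp (- x)"
  proof -
    have "x + 1 \<le> 2 * x\<^sup>2"
      using x self_le_power[of x 2] by linarith
    then have "(x + 1) * exp (- x) \<le> (2 * x\<^sup>2) * exp (- x)"
      by (rule mult_right_mono) simp
    then show ?thesis by (simp add: algebra_simps)
  qed
  also have "\<dots> \<le> (2 * x\<^sup>2) * (27 / x ^ 3)"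
    using x exp_minus_le_cube[of x] by (intro mult_left_mono) auto
  also have "\<dots> = 54 * (1 / x)"
    using x by (simp add: field_simps power2_eq_square power3_eq_cube)
  also have "\<dots> \<le> 54 * (1 / sqrt x)"
    using sqrt_sandwich(2)[OF x] by simp
  finally show "\<bar>hbin (exp (- x))\<bar> \<le> 54 / sqrt x"
    using x hbin_nonneg[of "exp (- x)"] by simp
qed

section \<open>Exponentially tilted integrals\<close>

text \<open>For \<open>s = 1 / (q - 1)\<close> the weight is the factor \<open>exp (- a)\<close>
  after the substitution \<open>exp v = (q - 1) * a\<close>. For \<open>s = 0\<close> the weight is
  1, which yields the constants.\<close>

definition tilted_integral :: "real \<Rightarrow> (real \<Rightarrow> real) \<Rightarrow> real" where
  "tilted_integral s f = (\<integral>v. exp (- s * exp v) * f v \<partial>lborel)"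

lemma integrable_tilted:
  fixes f :: "real \<Rightarrow> real" and s :: real
  assumes "integrable lborel f" "0 \<le> s"
  shows "integrable lborel (\<lambda>v. exp (- s * exp v) * f v)"
  using assms(1)
proof (rule Bochner_Integration.integrable_bound)
  show "(\<lambda>v. exp (- s * exp v) * f v) \<in> borel_measurable lborel"
    using borel_measurable_integrable[OF assms(1)] by (intro borel_measurable_times)
      (auto intro!: borel_measurable_continuous_onI continuous_intros)
  have "exp (- s * exp v) * \<bar>f v\<bar> \<le> 1 * \<bar>f v\<bar>" for v
    using assms(2) by (intro mult_right_mono) auto
  then show "AE v in lborel. norm (exp (- s * exp v) * f v) \<le> norm (f v)"
    by (auto simp: abs_mult)
qed

text \<open>For \<open>q > 1\<close> the weight is at most 1, and it tends to 1 pointwise, so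
  \<open>\<bar>f v\<bar>\<close> dominates.\<close>

lemma tilted_integral_tendsto:
  assumes f: "integrable lborel f"
  shows "((\<lambda>q. tilted_integral (1 / (q - 1)) f) \<longlongrightarrow> tilted_integral 0 f) at_top"
  unfolding tilted_integral_def
proof (rule integral_dominated_convergence_at_top[where w = "\<lambda>v. \<bar>f v\<bar>"])
  have [measurable]: "f \<in> borel_measurable borel"
    using borel_measurable_integrable[OF f] by simp
  show "(\<lambda>v. exp (- 0 * exp v) * f v) \<in> borel_measurable lborel"
    "(\<lambda>v. exp (- (1 / (q - 1)) * exp v) * f v) \<in> borel_measurable lborel" for q :: real
    by measurable
  show "integrable lborel (\<lambda>v. \<bar>f v\<bar>)"
    using f by simp
  have "norm (exp (- (1 / (q - 1)) * exp v) * f v) \<le> \<bar>f v\<bar>" if "1 < q" for q v :: real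
    using that by (auto simp: abs_mult intro!: mult_left_le_one_le)
  then show "\<forall>\<^sub>F q in at_top. AE v in lborel. norm (exp (- (1 / (q - 1)) * exp v) * f v) \<le> \<bar>f v\<bar>"
    by (intro eventually_mono[OF eventually_gt_at_top[of "1::real"]] AE_I2) auto
  have "filterlim (\<lambda>q::real. -1 + q) at_top at_top"
    by (rule filterlim_tendsto_add_at_top[OF tendsto_const filterlim_ident])
  then have "((\<lambda>q::real. 1 / (q - 1)) \<longlongrightarrow> 0) at_top"
    by (intro real_tendsto_divide_at_top[OF tendsto_const]) simp
  then show "AE v in lborel. ((\<lambda>q. exp (- (1 / (q - 1)) * exp v) * f v) \<longlongrightarrow> exp (- 0 * exp v) * f v) at_top"
    by (intro AE_I2 tendsto_intros)
qed

text \<open>The two \<open>T\<close> terms are translates of each other, so their integrals cancel.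
  Rescaling by \<open>ln q\<close> produces the denominator.\<close>

lemma has_integral_telescoping_periodization:
  fixes T f F :: "real \<Rightarrow> real"
  assumes q: "1 < q" and T: "integrable lborel T" and f: "integrable lborel f"
    and F: "\<And>w. F w = T (w * ln q) - T (ln q + w * ln q)
      + exp (- exp (w * ln q)) * f (ln (q - 1) + w * ln q)"
    and nonneg: "\<And>w. 0 \<le> F w"
  shows "((\<lambda>r. \<Sum>\<^sub>\<infinity>k\<in>(UNIV::int set). F (r - of_int k)) has_integral
    tilted_integral (1 / (q - 1)) f / ln q) {0..1}"
proof -
  define s where "s = 1 / (q - 1)"
  define M where "M v = exp (- s * exp v) * f v" for v
  have lq: "0 < ln q" using q by simp
  have M: "integrable lborel M"
    unfolding M_def using q f by (intro integrable_tilted) (auto simp: s_def)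
  have affine: "integrable lborel (\<lambda>w. u (t + ln q * w))"
      "(\<integral>w. u (t + ln q * w) \<partial>lborel) = (\<integral>w. u w \<partial>lborel) / ln q"
    if "integrable lborel u" for u :: "real \<Rightarrow> real" and t
    using lborel_integrable_real_affine[OF that, of "ln q" t]
      lborel_integral_real_affine[of "ln q" u t] lq by auto
  \<comment> \<open>At \<open>v = ln (q - 1) + ln q * w\<close> one has
    \<open>s * exp v = exp (ln q * w)\<close>, which turns the last term into \<open>M\<close>. The
    explicit \<open>0 +\<close> gives the shape of \<open>affine\<close>.\<close>
  have F': "F = (\<lambda>w. T (0 + ln q * w) - T (ln q + ln q * w) + M (ln (q - 1) + ln q * w))"
    using q by (auto simp: F M_def s_def exp_add mult.commute)
  have "integrable lborel F"
    unfolding F' by (intro Bochner_Integration.integrable_add Bochner_Integration.integrable_diff affine T M)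
  moreover have "(\<integral>w. F w \<partial>lborel) = tilted_integral s f / ln q"
    unfolding F' using affine[OF T] affine[OF M]
    by (simp add: tilted_integral_def M_def del: add_0)
  ultimately show ?thesis
    using has_integral_periodization[of F] nonneg by (simp add: s_def)
qed

section \<open>Entropy and Fisher information of the sketch\<close>

text \<open>Memorylessness is the factorization \<open>p = exp (- a) * (1 - exp (- d))\<close>,
  which splits \<open>ln p\<close> into \<open>- a\<close> and a term in \<open>d\<close>
  alone.\<close>

lemma entropy_chain_rule:
  fixes a d :: real
  assumes "0 < d"
  defines "p \<equiv> exp (- a) - exp (- (a + d))"
  shows "- p * ln p = a * exp (- a) - (a + d) * exp (- (a + d)) + exp (- a) * hbin (exp (- d))"
proof -
  have p: "p = exp (- a) * (1 - exp (- d))"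
    by (simp add: p_def algebra_simps flip: exp_add)
  have ln_p: "ln p = - a + ln (1 - exp (- d))"
    unfolding p using assms(1) by (subst ln_mult_pos) auto
  have e: "exp (- (a + d)) = exp (- a) * exp (- d)"
    by (simp flip: exp_add)
  show ?thesis
    unfolding ln_p e hbin_def unfolding p by (simp add: algebra_simps)
qed

lemma fisher_chain_rule:
  fixes a d :: real
  assumes "0 < d"
  defines "b \<equiv> a + d"
  shows "(b * exp (- b) - a * exp (- a))\<^sup>2 / (exp (- a) - exp (- b))
    = a\<^sup>2 * exp (- a) - b\<^sup>2 * exp (- b) + exp (- a) * gfun d"
proof -
  define D E where "D = exp d" and "E = exp (- a)"
  have D: "1 < D" "0 < D" and E: "0 < E"
    using assms(1) by (auto simp: D_def E_def)
  have e: "exp (- b) = E / D"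
    by (simp add: b_def D_def E_def exp_diff[symmetric])
  have d: "d = b - a"
    by (simp add: b_def)
  have "b * (E / D) - a * E = E / D * (b - a * D)" "E - E / D = E / D * (D - 1)"
    using D by (simp_all add: field_simps)
  then have "(b * (E / D) - a * E)\<^sup>2 / (E - E / D) = (E / D)\<^sup>2 * (b - a * D)\<^sup>2 / (E / D * (D - 1))"
    by (simp only: power_mult_distrib)
  also have "\<dots> = E * (b - a * D)\<^sup>2 / (D * (D - 1))"
    using D E by (simp add: power2_eq_square)
  \<comment> \<open>This polynomial identity is the heart of the chain rule: it separates the two
    telescoping squares from the square of \<open>d = b - a\<close>.\<close>
  also have "(b - a * D)\<^sup>2 = a\<^sup>2 * (D * (D - 1)) - b\<^sup>2 * (D - 1) + d\<^sup>2 * D"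
    unfolding d by (simp add: power2_eq_square algebra_simps)
  also have "E * (a\<^sup>2 * (D * (D - 1)) - b\<^sup>2 * (D - 1) + d\<^sup>2 * D) / (D * (D - 1))
      = a\<^sup>2 * E - b\<^sup>2 * (E / D) + E * (d\<^sup>2 / (D - 1))"
  proof -
    \<comment> \<open>Writing \<open>K\<close> for \<open>D - 1\<close> keeps the simplifier from
      multiplying it out.\<close>
    have "E * (a\<^sup>2 * (D * K) - b\<^sup>2 * K + d\<^sup>2 * D) / (D * K) = a\<^sup>2 * E - b\<^sup>2 * (E / D) + E * (d\<^sup>2 / K)"
      if "K \<noteq> 0" for K
      using that D by (simp add: distrib_left right_diff_distrib add_divide_distrib diff_divide_distrib)
    then show ?thesis using D by simp
  qed
  finally show ?thesis
    unfolding e gfun_def D_def[symmetric] E_def[symmetric] .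
qed

text \<open>The dependence is on \<open>r - k\<close> alone, as periodization requires.\<close>

lemma psi_powr:
  assumes "1 < q"
  shows "psi q (q powr r) k = exp (- exp ((r - of_int k) * ln q)) - exp (- (q * exp ((r - of_int k) * ln q)))"
proof -
  have "q powr r / q powr of_int k = exp ((r - of_int k) * ln q)"
    using assms by (simp add: powr_def left_diff_distrib exp_diff)
  moreover have "q powr r / q powr (of_int k - 1) = q * exp ((r - of_int k) * ln q)"
    using assms by (simp add: powr_def left_diff_distrib exp_diff)
  ultimately show ?thesis
    by (simp add: psi_def)
qed

text \<open>Multiplying by the cardinality makes the derivative a function of \<open>r - k\<close>
  alone; its square absorbs the weight \<open>q powr (2 * r)\<close> in \<open>calI\<close>.\<close>

lemma scaled_deriv_psi:
  assumes "1 < q"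
  shows "q powr r * deriv (\<lambda>l. psi q l k) (q powr r)
    = q * exp ((r - of_int k) * ln q) * exp (- (q * exp ((r - of_int k) * ln q)))
      - exp ((r - of_int k) * ln q) * exp (- exp ((r - of_int k) * ln q))"
proof -
  have a: "q powr r / q powr of_int k = exp ((r - of_int k) * ln q)"
    using assms by (simp add: powr_def left_diff_distrib exp_diff)
  have b: "q powr r / q powr (of_int k - 1) = q * exp ((r - of_int k) * ln q)"
    using assms by (simp add: powr_def left_diff_distrib exp_diff)
  have "((\<lambda>l. psi q l k) has_real_derivative
      exp (- (l / q powr of_int k)) * (- 1 / q powr of_int k)
      - exp (- (l / q powr (of_int k - 1))) * (- 1 / q powr (of_int k - 1))) (at l)" for l
    unfolding psi_def using assms by (auto intro!: derivative_eq_intros)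
  then have "q powr r * deriv (\<lambda>l. psi q l k) (q powr r)
      = q powr r / q powr (of_int k - 1) * exp (- (q powr r / q powr (of_int k - 1)))
        - q powr r / q powr of_int k * exp (- (q powr r / q powr of_int k))"
    by (subst DERIV_imp_deriv, assumption) (simp add: algebra_simps)
  then show ?thesis
    unfolding a b .
qed

text \<open>These identify \<open>b = q * a\<close> and \<open>d = (q - 1) * a\<close>, for
  \<open>a = exp w\<close>, as exponentials of shifts of \<open>w\<close>.\<close>

lemma
  fixes q w :: real
  assumes "1 < q"
  shows exp_shift_ln: "exp (ln q + w) = q * exp w" "exp (ln (q - 1) + w) = (q - 1) * exp w"
    and split_exp: "q * exp w = exp w + (q - 1) * exp w" "0 < (q - 1) * exp w"
  using assms by (auto simp: exp_add algebra_simps)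

lemma calH_eq:
  assumes q: "1 < q"
  shows "calH q = tilted_integral (1 / (q - 1)) (\<lambda>v. hbin (exp (- exp v))) / ln q / ln 2"
proof -
  define p where "p w = exp (- exp (w * ln q)) - exp (- (q * exp (w * ln q)))" for w
  have p: "0 < p w" "p w < 1" for w
  proof -
    show "0 < p w" using q by (simp add: p_def)
    have "exp (- exp (w * ln q)) < 1" by simp
    then show "p w < 1" unfolding p_def using exp_gt_zero[of "- (q * exp (w * ln q))"] by linarith
  qed
  have "((\<lambda>r. \<Sum>\<^sub>\<infinity>k\<in>(UNIV::int set). - p (r - of_int k) * ln (p (r - of_int k))) has_integral
      tilted_integral (1 / (q - 1)) (\<lambda>v. hbin (exp (- exp v))) / ln q) {0..1}"
  \<comment> \<open>Here \<open>T\<close> is \<open>a * exp (- a)\<close> at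
    \<open>a = exp v\<close>.\<close>
  proof (rule has_integral_telescoping_periodization[where T = "\<lambda>v. exp v ^ 1 * exp (- exp v)"
        and F = "\<lambda>w. - p w * ln (p w)"])
    show "0 \<le> - p w * ln (p w)" for w
      using p[of w] by (simp add: mult_nonneg_nonpos)
    fix w
    show "- p w * ln (p w) = exp (w * ln q) ^ 1 * exp (- exp (w * ln q))
        - exp (ln q + w * ln q) ^ 1 * exp (- exp (ln q + w * ln q))
        + exp (- exp (w * ln q)) * hbin (exp (- exp (ln (q - 1) + w * ln q)))"
      using entropy_chain_rule[OF split_exp(2)[OF q], of "exp (w * ln q)" "w * ln q"]
      unfolding p_def exp_shift_ln[OF q] split_exp(1)[OF q, symmetric] by simp
  qed (use q integrable_power_exp_exp[of 1] integrable_hbin in auto)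
  then have "((\<lambda>r. (\<Sum>\<^sub>\<infinity>k\<in>(UNIV::int set). - p (r - of_int k) * ln (p (r - of_int k))) / ln 2) has_integral
      tilted_integral (1 / (q - 1)) (\<lambda>v. hbin (exp (- exp v))) / ln q / ln 2) {0..1}"
    by (rule has_integral_divide)
  moreover have "entropyLL q (q powr r) = (\<Sum>\<^sub>\<infinity>k\<in>(UNIV::int set). - p (r - of_int k) * ln (p (r - of_int k))) / ln 2" for r
  proof -
    have "entropyLL q (q powr r) = (\<Sum>\<^sub>\<infinity>k\<in>(UNIV::int set). - p (r - of_int k) * ln (p (r - of_int k)) * inverse (ln 2))"
      unfolding entropyLL_def psi_powr[OF q] p_def[symmetric] log_def infsum_uminus[symmetric]
      by (simp add: divide_inverse mult.assoc)
    also have "\<dots> = (\<Sum>\<^sub>\<infinity>k\<in>(UNIV::int set). - p (r - of_int k) * ln (p (r - of_int k))) * inverse (ln 2)"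
      by (rule infsum_cmult_left')
    finally show ?thesis by (simp add: divide_inverse)
  qed
  ultimately show ?thesis
    unfolding calH_def by (simp only: integral_unique)
qed

lemma calI_eq:
  assumes q: "1 < q"
  shows "calI q = tilted_integral (1 / (q - 1)) (\<lambda>v. gfun (exp v)) / ln q"
proof -
  define X where "X w = (q * exp (w * ln q) * exp (- (q * exp (w * ln q))) - exp (w * ln q) * exp (- exp (w * ln q)))\<^sup>2
    / (exp (- exp (w * ln q)) - exp (- (q * exp (w * ln q))))" for w
  have "((\<lambda>r. \<Sum>\<^sub>\<infinity>k\<in>(UNIV::int set). X (r - of_int k)) has_integral
      tilted_integral (1 / (q - 1)) (\<lambda>v. gfun (exp v)) / ln q) {0..1}"
  proof (rule has_integral_telescoping_periodization[where T = "\<lambda>v. exp v ^ 2 * exp (- exp v)" and F = X])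
    show "0 \<le> X w" for w
      using q by (simp add: X_def)
    fix w
    show "X w = exp (w * ln q) ^ 2 * exp (- exp (w * ln q))
        - exp (ln q + w * ln q) ^ 2 * exp (- exp (ln q + w * ln q))
        + exp (- exp (w * ln q)) * gfun (exp (ln (q - 1) + w * ln q))"
      using fisher_chain_rule[OF split_exp(2)[OF q], of "exp (w * ln q)" "w * ln q"]
      unfolding X_def exp_shift_ln[OF q] split_exp(1)[OF q, symmetric] by simp
  qed (use q integrable_power_exp_exp[of 2] integrable_gfun in auto)
  moreover have "q powr (2 * r) * fisherLL q (q powr r) = (\<Sum>\<^sub>\<infinity>k\<in>(UNIV::int set). X (r - of_int k))" for r
  proof -
    have "q powr (2 * r) = (q powr r)\<^sup>2"
      using q by (simp add: powr_power mult.commute)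
    then have "q powr (2 * r) * ((deriv (\<lambda>l. psi q l k) (q powr r))\<^sup>2 / psi q (q powr r) k) = X (r - of_int k)" for k
      unfolding X_def scaled_deriv_psi[OF q, symmetric] psi_powr[OF q, symmetric]
      by (simp add: power_mult_distrib)
    then show ?thesis
      unfolding fisherLL_def by (simp flip: infsum_cmult_right')
  qed
  ultimately show ?thesis
    unfolding calI_def by (simp only: integral_unique)
qed

section \<open>Comparison of the ratio of tilted integrals with its limit\<close>

lemma H0_eq: "H0 = tilted_integral 0 (\<lambda>v. hbin (exp (- exp v))) / ln 2"
  unfolding H0_def integral_lborel[OF integrable_hbin] by (simp add: tilted_integral_def)

lemma I0_eq: "I0 = tilted_integral 0 (\<lambda>v. gfun (exp v))"
  unfolding I0_def integral_lborel[OF integrable_gfun] by (simp add: tilted_integral_def)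

lemma Fish_eq:
  assumes "1 < q"
  shows "Fish q = tilted_integral (1 / (q - 1)) (\<lambda>v. hbin (exp (- exp v))) / ln 2
    / tilted_integral (1 / (q - 1)) (\<lambda>v. gfun (exp v))"
  using assms by (simp add: Fish_def calH_eq calI_eq)

lemma tilted_gfun_pos: "0 \<le> s \<Longrightarrow> 0 < tilted_integral s (\<lambda>v. gfun (exp v))"
  unfolding tilted_integral_def
  by (rule integral_pos_except_point[OF integrable_tilted[OF integrable_gfun], of _ 0])
    (auto simp: gfun_pos less_imp_le)

text \<open>Chebyshev's inequality for the decreasing functions \<open>hg_quotient (exp v)\<close>
  and \<open>exp (- s * exp v)\<close> against the density \<open>gfun (exp v)\<close>; strict
  decrease of the weight uses \<open>0 < s\<close>.\<close>

lemma tilted_hbin_gfun_less: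
  assumes s: "0 < s"
  shows "tilted_integral 0 (\<lambda>v. hbin (exp (- exp v))) * tilted_integral s (\<lambda>v. gfun (exp v))
    < tilted_integral s (\<lambda>v. hbin (exp (- exp v))) * tilted_integral 0 (\<lambda>v. gfun (exp v))"
proof -
  have "continuous_on UNIV (\<lambda>v. hg_quotient (exp v))"
    unfolding hg_quotient_def by (intro continuous_intros) auto
  then have "(\<integral>v. hg_quotient (exp v) * gfun (exp v) \<partial>lborel) * (\<integral>v. exp (- s * exp v) * gfun (exp v) \<partial>lborel)
    < (\<integral>v. exp (- s * exp v) * (hg_quotient (exp v) * gfun (exp v)) \<partial>lborel) * (\<integral>v. gfun (exp v) \<partial>lborel)"
  proof (rule integral_decreasing_correlation)
    show "integrable lborel (\<lambda>v. exp (- s * exp v) * gfun (exp v))"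
      using s integrable_gfun by (intro integrable_tilted) auto
    show "integrable lborel (\<lambda>v. exp (- s * exp v) * (hg_quotient (exp v) * gfun (exp v)))"
      using s integrable_hbin by (intro integrable_tilted) (auto simp: hbin_eq_hg_quotient)
  qed (use s integrable_gfun integrable_hbin in
      \<open>auto simp: gfun_pos hbin_eq_hg_quotient hg_quotient_strict_decreasing\<close>)
  then show ?thesis
    by (simp add: tilted_integral_def hbin_eq_hg_quotient)
qed

theorem mainTheorem5:
  shows "(\<forall>q::real. q > 1 \<longrightarrow> Fish q > H0 / I0) \<and> (Fish \<longlongrightarrow> H0 / I0) at_top"
proof (intro conjI allI impI)
  fix q :: real
  assume q: "1 < q"
  let ?s = "1 / (q - 1)"
  have "0 < ?s" using q by simp
  \<comment> \<open>Positivity of both \<open>gfun\<close> integrals turns the inequality of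
    products into one of ratios.\<close>
  from tilted_hbin_gfun_less[OF this] show "H0 / I0 < Fish q"
    using q tilted_gfun_pos[of 0] tilted_gfun_pos[of ?s]
    unfolding Fish_eq[OF q] H0_eq I0_eq by (simp add: divide_simps mult.commute)
next
  have "((\<lambda>q. tilted_integral (1 / (q - 1)) (\<lambda>v. hbin (exp (- exp v))) / ln 2
      / tilted_integral (1 / (q - 1)) (\<lambda>v. gfun (exp v))) \<longlongrightarrow> H0 / I0) at_top"
    unfolding H0_eq I0_eq using tilted_gfun_pos[of 0]
    by (intro tendsto_divide tilted_integral_tendsto integrable_hbin integrable_gfun tendsto_const) auto
  \<comment> \<open>The formula for \<open>Fish\<close> is established for \<open>q > 1\<close>,
    hence holds eventually.\<close>
  moreover have "\<forall>\<^sub>F q in at_top. tilted_integral (1 / (q - 1)) (\<lambda>v. hbin (exp (- exp v))) / ln 2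
      / tilted_integral (1 / (q - 1)) (\<lambda>v. gfun (exp v)) = Fish q"
    using eventually_gt_at_top[of "1::real"] by eventually_elim (rule Fish_eq[symmetric])
  ultimately show "(Fish \<longlongrightarrow> H0 / I0) at_top"
    by (rule Lim_transform_eventually)
qed

end
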